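(* Let $B\colon\mathsf{Set}\to\mathsf{Set}$ be a polynomial functor with final coalgebra $(B_\omega,\zeta)$, let $F\colon\mathsf{Set}\to\mathsf{Set}$ be a functor and $\alpha\colon FB_\omega\to B_\omega$ a causal algebra. Then coinduction up to $\alpha$ is valid: for every set $X$ and map $g\colon X\to BFX$ there exists a unique $\hat g\colon X\to B_\omega$ such that $\zeta\circ\hat g=B\alpha\circ BF\hat g\circ g$.
   Context: $B$ is polynomial if isomorphic to $X\mapsto\coprod_{a\in I}X^{E_a}$ for some family of sets $(E_a)_{a\in I}$. Final sequence: $B_0=1$, $B_{i+1}=BB_i$, $B_j=\lim_{i<j}B_i$ for limit $j$, with connecting maps $B_{j,i}\colon B_j\to B_i$, $B_{i,i}=\mathrm{id}$, $B_{j+1,i+1}=BB_{j,i}$; for polynomial $B$, $B_\omega$ carries the final coalgebra. An algebra $\alpha\colon FB_\omega\to B_\omega$ is causal if for every set $X$, all $f,g\colon X\to B_\omega$ and every $i<\omega$, $B_{\omega,i}\circ f=B_{\omega,i}\circ g$ implies $B_{\omega,i}\circ\alpha\circ Ff=B_{\omega,i}\circ\alpha\circ Fg$. *)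

theory Defs
  imports "HOL-Library.FuncSet"
begin

text \<open>
  The category Set is modelled by a collection \<open>U\<close> of sets over a type \<open>'u\<close> (its objects);
  morphisms from \<open>X\<close> to \<open>Y\<close> are the extensional functions \<open>X \<rightarrow>\<^sub>E Y\<close>, with composition
  \<^const>\<open>compose\<close>.  HOL has no type of all sets, so \<open>U\<close> and \<open>'u\<close> stay arbitrary. No closure
  property of \<open>U\<close> is imposed: \<open>U\<close> may be the collection of all sets of a set-theoretic universe
  (so that size-increasing functors such as the powerset functor are endofunctors of \<open>U\<close>), but
  nothing depends on the existence of a type carrying such a universe.
\<close>

text \<open>The action on morphisms takes domain and codomain as arguments, because an extensional
  function does not determine its codomain.\<close>

record 'u set_functor =
  obj :: "'u set \<Rightarrow> 'u set"
  arr :: "'u set \<Rightarrow> 'u set \<Rightarrow> ('u \<Rightarrow> 'u) \<Rightarrow> 'u \<Rightarrow> 'u"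

abbreviation idm :: "'a set \<Rightarrow> 'a \<Rightarrow> 'a"
  where "idm X \<equiv> (\<lambda>x\<in>X. x)"

definition is_functor :: "'u set set \<Rightarrow> 'u set_functor \<Rightarrow> bool"
  where "is_functor U T \<longleftrightarrow>
    (\<forall>X\<in>U. obj T X \<in> U) \<and>
    (\<forall>X\<in>U. \<forall>Y\<in>U. \<forall>f \<in> X \<rightarrow>\<^sub>E Y. arr T X Y f \<in> obj T X \<rightarrow>\<^sub>E obj T Y) \<and>
    (\<forall>X\<in>U. arr T X X (idm X) = idm (obj T X)) \<and>
    (\<forall>X\<in>U. \<forall>Y\<in>U. \<forall>Z\<in>U. \<forall>f \<in> X \<rightarrow>\<^sub>E Y. \<forall>g \<in> Y \<rightarrow>\<^sub>E Z.
       arr T X Z (compose X g f) = compose (obj T X) (arr T Y Z g) (arr T X Y f))"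

definition poly_obj :: "'i set \<Rightarrow> ('i \<Rightarrow> 'e set) \<Rightarrow> 'u set \<Rightarrow> ('i \<times> ('e \<Rightarrow> 'u)) set"
  where "poly_obj I E X = (SIGMA a:I. E a \<rightarrow>\<^sub>E X)"

definition poly_arr :: "('i \<Rightarrow> 'e set) \<Rightarrow> ('u \<Rightarrow> 'u) \<Rightarrow> 'i \<times> ('e \<Rightarrow> 'u) \<Rightarrow> 'i \<times> ('e \<Rightarrow> 'u)"
  where "poly_arr E f = (\<lambda>(a, h). (a, compose (E a) f h))"

text \<open>\<open>\<phi>\<close> is a natural isomorphism from \<open>B\<close> to the functor \<open>X \<mapsto> \<Coprod>a\<in>I. X\<^bsup>E a\<^esup>\<close>.\<close>

definition polynomial :: "'u set set \<Rightarrow> 'u set_functor \<Rightarrow> bool"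
  where "polynomial U B \<longleftrightarrow> is_functor U B \<and>
    (\<exists>(I :: 'u set) (E :: 'u \<Rightarrow> 'u set) \<phi>.
       (\<forall>X\<in>U. bij_betw (\<phi> X) (obj B X) (poly_obj I E X)) \<and>
       (\<forall>X\<in>U. \<forall>Y\<in>U. \<forall>f \<in> X \<rightarrow>\<^sub>E Y. \<forall>x \<in> obj B X.
          \<phi> Y (arr B X Y f x) = poly_arr E f (\<phi> X x)))"

text \<open>The finite part of the final sequence, starting from the one-element set \<open>{pt}\<close>.\<close>

fun fin_seq :: "'u set_functor \<Rightarrow> 'u \<Rightarrow> nat \<Rightarrow> 'u set"
  where
    "fin_seq B pt 0 = {pt}"
  | "fin_seq B pt (Suc i) = obj B (fin_seq B pt i)"

text \<open>\<open>fin_conn B pt j i\<close> is the connecting map from stage \<open>j\<close> to stage \<open>i\<close>; it is meaningful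
  only for \<open>i \<le> j\<close>.\<close>

fun fin_conn :: "'u set_functor \<Rightarrow> 'u \<Rightarrow> nat \<Rightarrow> nat \<Rightarrow> 'u \<Rightarrow> 'u"
  where
    "fin_conn B pt j 0 = (\<lambda>x\<in>fin_seq B pt j. pt)"
  | "fin_conn B pt (Suc j) (Suc i) =
       arr B (fin_seq B pt j) (fin_seq B pt i) (fin_conn B pt j i)"
  | "fin_conn B pt 0 (Suc i) = undefined"

lemma fin_seq_in:
  assumes "is_functor U B" "{pt} \<in> U"
  shows "fin_seq B pt i \<in> U"
  using assms by (induction i) (auto simp: is_functor_def)

lemma fin_conn_in:
  assumes "is_functor U B" "{pt} \<in> U" "i \<le> j"
  shows "fin_conn B pt j i \<in> fin_seq B pt j \<rightarrow>\<^sub>E fin_seq B pt i"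
  using assms(3)
proof (induction i arbitrary: j)
  case (Suc i)
  then obtain k where "j = Suc k" "i \<le> k"
    by (cases j) auto
  with Suc.IH show ?case
    using assms(1) fin_seq_in[OF assms(1,2)] by (simp add: is_functor_def)
qed auto

lemma fin_conn_refl:
  assumes "is_functor U B" "{pt} \<in> U"
  shows "fin_conn B pt i i = idm (fin_seq B pt i)"
proof (induction i)
  case (Suc i)
  have "arr B X X (idm X) = idm (obj B X)" if "X \<in> U" for X
    using assms(1) that unfolding is_functor_def by blast
  then show ?case
    using Suc fin_seq_in[OF assms] by (simp del: restrict_apply)
qed (auto simp: fun_eq_iff)

lemma fin_conn_trans:
  assumes "is_functor U B" "{pt} \<in> U" "i \<le> j" "j \<le> k"
  shows "compose (fin_seq B pt k) (fin_conn B pt j i) (fin_conn B pt k j) = fin_conn B pt k i"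
  using assms(3,4)
proof (induction i arbitrary: j k)
  case 0
  then show ?case
    using fin_conn_in[OF assms(1,2) \<open>j \<le> k\<close>] by (auto simp: compose_def fun_eq_iff)
next
  case (Suc i)
  then obtain j' k' where jk: "j = Suc j'" "k = Suc k'" "i \<le> j'" "j' \<le> k'"
    by (metis Suc_le_D Suc_le_mono order_trans)
  have comp: "arr B X Z (compose X g f) = compose (obj B X) (arr B Y Z g) (arr B X Y f)"
    if "X \<in> U" "Y \<in> U" "Z \<in> U" "f \<in> X \<rightarrow>\<^sub>E Y" "g \<in> Y \<rightarrow>\<^sub>E Z" for X Y Z f g
    using assms(1) that unfolding is_functor_def by blast
  show ?case
    using comp[OF fin_seq_in[OF assms(1,2)] fin_seq_in[OF assms(1,2)] fin_seq_in[OF assms(1,2)]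
        fin_conn_in[OF assms(1,2) jk(4)] fin_conn_in[OF assms(1,2) jk(3)]]
      Suc.IH[OF jk(3,4)] jk(1,2)
    by simp
qed

text \<open>Limit cones, in the category with objects \<open>U\<close>, over a chain \<open>D\<close> with connecting maps
  \<open>c j i\<close> from \<open>D j\<close> to \<open>D i\<close> for \<open>i \<le> j\<close>.\<close>

definition is_cone ::
    "(nat \<Rightarrow> 'u set) \<Rightarrow> (nat \<Rightarrow> nat \<Rightarrow> 'u \<Rightarrow> 'u) \<Rightarrow> 'u set \<Rightarrow> (nat \<Rightarrow> 'u \<Rightarrow> 'u) \<Rightarrow> bool"
  where "is_cone D c Y q \<longleftrightarrow>
    (\<forall>i. q i \<in> Y \<rightarrow>\<^sub>E D i) \<and> (\<forall>i j. i \<le> j \<longrightarrow> compose Y (c j i) (q j) = q i)"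

definition is_limit ::
    "'u set set \<Rightarrow> (nat \<Rightarrow> 'u set) \<Rightarrow> (nat \<Rightarrow> nat \<Rightarrow> 'u \<Rightarrow> 'u) \<Rightarrow> 'u set \<Rightarrow> (nat \<Rightarrow> 'u \<Rightarrow> 'u) \<Rightarrow> bool"
  where "is_limit U D c W p \<longleftrightarrow>
    W \<in> U \<and> is_cone D c W p \<and>
    (\<forall>Y\<in>U. \<forall>q. is_cone D c Y q \<longrightarrow>
       (\<exists>!u. u \<in> Y \<rightarrow>\<^sub>E W \<and> (\<forall>i. compose Y (p i) u = q i)))"

text \<open>\<open>W\<close> with projections \<open>p i\<close> is stage \<open>\<omega>\<close> of the final sequence, with connecting maps
  \<open>p i\<close> to the finite stages.\<close>

definition omega_stage ::
    "'u set set \<Rightarrow> 'u set_functor \<Rightarrow> 'u \<Rightarrow> 'u set \<Rightarrow> (nat \<Rightarrow> 'u \<Rightarrow> 'u) \<Rightarrow> bool"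
  where "omega_stage U B pt W p \<longleftrightarrow>
    {pt} \<in> U \<and> is_limit U (fin_seq B pt) (fin_conn B pt) W p"

definition final_coalgebra :: "'u set set \<Rightarrow> 'u set_functor \<Rightarrow> 'u set \<Rightarrow> ('u \<Rightarrow> 'u) \<Rightarrow> bool"
  where "final_coalgebra U B W \<zeta> \<longleftrightarrow>
    W \<in> U \<and> \<zeta> \<in> W \<rightarrow>\<^sub>E obj B W \<and>
    (\<forall>X\<in>U. \<forall>c \<in> X \<rightarrow>\<^sub>E obj B X.
       \<exists>!h. h \<in> X \<rightarrow>\<^sub>E W \<and> compose X \<zeta> h = compose X (arr B X W h) c)"

text \<open>
  \<open>\<beta>\<close> is the connecting map from stage \<open>\<omega> + 1\<close> to stage \<open>\<omega>\<close>, that is, the map into the limit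
  whose component at \<open>i + 1\<close> is the connecting map from \<open>\<omega> + 1\<close> to \<open>i + 1\<close>, namely \<open>B\<close> applied to
  \<open>p i\<close> (the component at 0 is forced).  The coalgebra structure carried by stage \<open>\<omega>\<close> is the
  inverse of \<open>\<beta>\<close>.  Finality alone does not determine \<open>\<zeta>\<close>: it can be conjugated by any bijection of
  \<open>W\<close>, which need not respect the projections.
\<close>

definition carried_by_omega_stage ::
    "'u set_functor \<Rightarrow> 'u \<Rightarrow> 'u set \<Rightarrow> (nat \<Rightarrow> 'u \<Rightarrow> 'u) \<Rightarrow> ('u \<Rightarrow> 'u) \<Rightarrow> bool"
  where "carried_by_omega_stage B pt W p \<zeta> \<longleftrightarrow>
    (\<exists>\<beta> \<in> obj B W \<rightarrow>\<^sub>E W.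
       (\<forall>i. compose (obj B W) (p (Suc i)) \<beta> = arr B W (fin_seq B pt i) (p i)) \<and>
       compose W \<beta> \<zeta> = idm W \<and> compose (obj B W) \<zeta> \<beta> = idm (obj B W))"

definition causal ::
    "'u set set \<Rightarrow> 'u set_functor \<Rightarrow> 'u set \<Rightarrow> (nat \<Rightarrow> 'u \<Rightarrow> 'u) \<Rightarrow> ('u \<Rightarrow> 'u) \<Rightarrow> bool"
  where "causal U F W p \<alpha> \<longleftrightarrow>
    (\<forall>X\<in>U. \<forall>f \<in> X \<rightarrow>\<^sub>E W. \<forall>g \<in> X \<rightarrow>\<^sub>E W. \<forall>i.
       compose X (p i) f = compose X (p i) g \<longrightarrow>
       compose (obj F X) (p i) (compose (obj F X) \<alpha> (arr F X W f)) =
       compose (obj F X) (p i) (compose (obj F X) \<alpha> (arr F X W g)))"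

end

theory Submission
  imports Defs
begin

text \<open>
  Let \<open>\<beta>\<close> be the inverse of \<open>\<zeta>\<close>. The solutions are the fixed points of
  \<open>\<Phi> h = \<beta> \<circ> B \<alpha> \<circ> B F h \<circ> g\<close>.  Since \<open>p (i + 1) \<circ> \<beta> = B (p i)\<close>, causality makes \<open>\<Phi>\<close>
  contractive: if \<open>h\<close> and \<open>h'\<close> agree up to stage \<open>i\<close>, then \<open>\<Phi> h\<close> and \<open>\<Phi> h'\<close> agree up to stage
  \<open>i + 1\<close>.  So the iterates of \<open>\<Phi>\<close> from any starting map converge to its only fixed point.
  A starting map \<open>X \<rightarrow> W\<close> exists because, if \<open>X\<close> is inhabited, \<open>g\<close> yields an element of \<open>B 1\<close>,
  hence a coalgebra on \<open>1\<close>, hence by finality an element of \<open>W\<close>.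
\<close>

lemma functor_obj: "is_functor U T \<Longrightarrow> X \<in> U \<Longrightarrow> obj T X \<in> U"
  by (simp add: is_functor_def)

lemma functor_arr:
  "is_functor U T \<Longrightarrow> X \<in> U \<Longrightarrow> Y \<in> U \<Longrightarrow> f \<in> X \<rightarrow>\<^sub>E Y \<Longrightarrow> arr T X Y f \<in> obj T X \<rightarrow>\<^sub>E obj T Y"
  unfolding is_functor_def by blast

lemma functor_compose:
  "is_functor U T \<Longrightarrow> X \<in> U \<Longrightarrow> Y \<in> U \<Longrightarrow> Z \<in> U \<Longrightarrow> f \<in> X \<rightarrow>\<^sub>E Y \<Longrightarrow> g \<in> Y \<rightarrow>\<^sub>E Z \<Longrightarrow>
    arr T X Z (compose X g f) = compose (obj T X) (arr T Y Z g) (arr T X Y f)"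
  unfolding is_functor_def by blast

lemma compose_in_extensional_funcset:
  "f \<in> X \<rightarrow>\<^sub>E Y \<Longrightarrow> g \<in> Y \<rightarrow>\<^sub>E Z \<Longrightarrow> compose X g f \<in> X \<rightarrow>\<^sub>E Z"
  by (auto simp: compose_def)

lemma compose_assoc_extensional:
  "f \<in> X \<rightarrow>\<^sub>E Y \<Longrightarrow> compose X h (compose X g f) = compose X (compose Y h g) f"
  by (rule compose_assoc) auto

lemma compose_idm_left: "f \<in> X \<rightarrow>\<^sub>E Y \<Longrightarrow> compose X (idm Y) f = f"
  by (rule Id_compose) (auto simp: PiE_def)

lemma cone_precompose:
  assumes "is_cone D c W p" "f \<in> X \<rightarrow>\<^sub>E W"
  shows "is_cone D c X (\<lambda>i. compose X (p i) f)"
  using assms compose_assoc_extensional[OF assms(2)] compose_in_extensional_funcset[OF assms(2)]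
  unfolding is_cone_def by metis

text \<open>Both maps mediate the cone that \<open>f\<close> induces by precomposition, and
  mediating maps are unique.\<close>

lemma limit_projections_jointly_monic:
  assumes lim: "is_limit U D c W p" and "X \<in> U"
    and f: "f \<in> X \<rightarrow>\<^sub>E W" and "f' \<in> X \<rightarrow>\<^sub>E W"
    and "\<And>i. compose X (p i) f = compose X (p i) f'"
  shows "f = f'"
proof -
  have "is_cone D c X (\<lambda>i. compose X (p i) f)"
    using lim f by (auto simp: is_limit_def intro: cone_precompose)
  then have "\<exists>!u. u \<in> X \<rightarrow>\<^sub>E W \<and> (\<forall>i. compose X (p i) u = compose X (p i) f)"
    using lim \<open>X \<in> U\<close> by (simp add: is_limit_def)
  then show ?thesis
    using assms(3-5) by metis
qed

text \<open>A form of Banach's fixed point theorem: agreement under \<open>p i\<close> acts as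
  distance at most 1/2^i, and existence of mediating maps into the limit acts as
  completeness.\<close>

lemma limit_contraction_unique_fixpoint:
  assumes lim: "is_limit U D c W p" and X: "X \<in> U"
    and h0: "h0 \<in> X \<rightarrow>\<^sub>E W"
    and \<Phi>: "\<And>f. f \<in> X \<rightarrow>\<^sub>E W \<Longrightarrow> \<Phi> f \<in> X \<rightarrow>\<^sub>E W"
    and base: "\<And>f f'. f \<in> X \<rightarrow>\<^sub>E W \<Longrightarrow> f' \<in> X \<rightarrow>\<^sub>E W \<Longrightarrow> compose X (p 0) f = compose X (p 0) f'"
    and step: "\<And>f f' i. f \<in> X \<rightarrow>\<^sub>E W \<Longrightarrow> f' \<in> X \<rightarrow>\<^sub>E W \<Longrightarrow>
      compose X (p i) f = compose X (p i) f' \<Longrightarrow>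
      compose X (p (Suc i)) (\<Phi> f) = compose X (p (Suc i)) (\<Phi> f')"
  shows "\<exists>!h. h \<in> X \<rightarrow>\<^sub>E W \<and> \<Phi> h = h"
proof -
  have iter: "(\<Phi> ^^ n) f \<in> X \<rightarrow>\<^sub>E W" if "f \<in> X \<rightarrow>\<^sub>E W" for n f
    using that \<Phi> by (induction n) auto
  have agree: "compose X (p i) ((\<Phi> ^^ i) f) = compose X (p i) ((\<Phi> ^^ i) f')"
    if "f \<in> X \<rightarrow>\<^sub>E W" "f' \<in> X \<rightarrow>\<^sub>E W" for f f' i
  proof (induction i)
    case 0
    show ?case by (simp add: base[OF that])
  next
    case (Suc i)
    show ?case
      using step[OF iter[OF that(1)] iter[OF that(2)] Suc.IH] by simp
  qed
  define h where "h n = (\<Phi> ^^ n) h0" for n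
  have h: "h n \<in> X \<rightarrow>\<^sub>E W" for n
    unfolding h_def using h0 by (rule iter)
  have stable: "compose X (p i) (h j) = compose X (p i) (h i)" if "i \<le> j" for i j
  proof -
    \<comment> \<open>Splitting off the last \<open>i\<close> of the \<open>j\<close> iterations
      makes \<open>h j\<close> an \<open>i\<close>-fold iterate with another start, so
      \<open>agree\<close> compares it with \<open>h i\<close>.\<close>
    have "h j = (\<Phi> ^^ i) (h (j - i))"
      using that funpow_add[of i "j - i" \<Phi>] by (simp add: h_def)
    then show ?thesis
      using agree[OF h[of "j - i"] h0, of i] by (simp add: h_def)
  qed
  \<comment> \<open>The diagonal is a cone because each single \<open>h j\<close> induces one, and
    \<open>stable\<close> replaces \<open>h j\<close> by \<open>h i\<close> at every stage i \<le>
    j.\<close>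
  have "is_cone D c X (\<lambda>i. compose X (p i) (h i))"
    unfolding is_cone_def
  proof (intro conjI allI impI)
    fix i j :: nat
    have cone: "is_cone D c X (\<lambda>i. compose X (p i) (h j))" for j
      using lim h by (auto simp: is_limit_def intro: cone_precompose)
    then show "compose X (p i) (h i) \<in> X \<rightarrow>\<^sub>E D i"
      unfolding is_cone_def by blast
    assume "i \<le> j"
    then show "compose X (c j i) (compose X (p j) (h j)) = compose X (p i) (h i)"
      using cone[of j] stable[of i j] by (simp add: is_cone_def)
  qed
  then have "\<exists>!u. u \<in> X \<rightarrow>\<^sub>E W \<and> (\<forall>i. compose X (p i) u = compose X (p i) (h i))"
    using lim X by (simp add: is_limit_def)
  then obtain u where u: "u \<in> X \<rightarrow>\<^sub>E W" and pu: "\<And>i. compose X (p i) u = compose X (p i) (h i)"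
    by blast
  have "\<Phi> u = u"
  proof (rule limit_projections_jointly_monic[OF lim X \<Phi>[OF u] u])
    fix i
    show "compose X (p i) (\<Phi> u) = compose X (p i) u"
    proof (cases i)
      case 0
      then show ?thesis using base \<Phi> u by blast
    next
      case (Suc k)
      \<comment> \<open>The limit \<open>u\<close> agrees with \<open>h k\<close> at stage
        \<open>k\<close>, so one more step compares \<Phi> \<open>u\<close> with \<Phi>
        \<open>(h k)\<close>, which is \<open>h (Suc k)\<close>.\<close>
      have "compose X (p (Suc k)) (\<Phi> u) = compose X (p (Suc k)) (\<Phi> (h k))"
        by (rule step[OF u h pu])
      then show ?thesis
        using pu[of i] Suc by (simp add: h_def)
    qed
  qed
  moreover have "f = f'"
    if f: "f \<in> X \<rightarrow>\<^sub>E W" "\<Phi> f = f" and f': "f' \<in> X \<rightarrow>\<^sub>E W" "\<Phi> f' = f'" for f f'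
  proof (rule limit_projections_jointly_monic[OF lim X f(1) f'(1)])
    fix i
    show "compose X (p i) f = compose X (p i) f'"
    proof (induction i)
      case 0
      show ?case by (rule base[OF f(1) f'(1)])
    next
      case (Suc i)
      show ?case
        using step[OF f(1) f'(1) Suc.IH] f(2) f'(2) by simp
    qed
  qed
  ultimately show ?thesis
    using u by metis
qed

text \<open>The map from \<open>Y\<close> to the point exists even when \<open>Y\<close> is empty,
  so an element of \<open>obj B Y\<close> suffices to obtain a coalgebra on the point.\<close>

lemma final_coalgebra_nonempty:
  assumes B: "is_functor U B" and pt: "{pt} \<in> U" and fin: "final_coalgebra U B W \<zeta>"
    and Y: "Y \<in> U" and y: "y \<in> obj B Y"
  shows "W \<noteq> {}"
proof -
  have "arr B Y {pt} (\<lambda>_\<in>Y. pt) \<in> obj B Y \<rightarrow>\<^sub>E obj B {pt}"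
    by (rule functor_arr[OF B Y pt]) auto
  then obtain b where "b \<in> obj B {pt}"
    using y by blast
  then have "(\<lambda>_\<in>{pt}. b) \<in> {pt} \<rightarrow>\<^sub>E obj B {pt}"
    by auto
  then obtain h where "h \<in> {pt} \<rightarrow>\<^sub>E W"
    using fin pt unfolding final_coalgebra_def by blast
  then show ?thesis
    by blast
qed

lemma compose_inverse_iff:
  assumes "\<zeta> \<in> W \<rightarrow>\<^sub>E V" "\<beta> \<in> V \<rightarrow>\<^sub>E W"
    and "compose W \<beta> \<zeta> = idm W" "compose V \<zeta> \<beta> = idm V"
    and h: "h \<in> X \<rightarrow>\<^sub>E W" and r: "r \<in> X \<rightarrow>\<^sub>E V"
  shows "compose X \<zeta> h = r \<longleftrightarrow> compose X \<beta> r = h"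
  using assms compose_assoc_extensional[OF h, of \<beta> \<zeta>] compose_assoc_extensional[OF r, of \<zeta> \<beta>]
    compose_idm_left[OF h] compose_idm_left[OF r]
  by metis

theorem theorem9p2:
  fixes U :: "'u set set"
    and B F :: "'u set_functor"
    and pt :: 'u
    and W :: "'u set"
    and p :: "nat \<Rightarrow> 'u \<Rightarrow> 'u"
    and \<zeta> \<alpha> :: "'u \<Rightarrow> 'u"
  assumes "polynomial U B"
    and "omega_stage U B pt W p"
    and "final_coalgebra U B W \<zeta>"
    and "carried_by_omega_stage B pt W p \<zeta>"
    and "is_functor U F"
    and "\<alpha> \<in> obj F W \<rightarrow>\<^sub>E W"
    and "causal U F W p \<alpha>"
  shows "\<forall>X\<in>U. \<forall>g \<in> X \<rightarrow>\<^sub>E obj B (obj F X).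
    \<exists>!h. h \<in> X \<rightarrow>\<^sub>E W \<and>
      compose X \<zeta> h =
      compose X (arr B (obj F W) W \<alpha>) (compose X (arr B (obj F X) (obj F W) (arr F X W h)) g)"
proof (intro ballI)
  fix X g
  assume X: "X \<in> U" and g: "g \<in> X \<rightarrow>\<^sub>E obj B (obj F X)"
  have B: "is_functor U B" using assms(1) by (simp add: polynomial_def)
  have pt: "{pt} \<in> U" and lim: "is_limit U (fin_seq B pt) (fin_conn B pt) W p"
    using assms(2) by (auto simp: omega_stage_def)
  have W: "W \<in> U" and \<zeta>: "\<zeta> \<in> W \<rightarrow>\<^sub>E obj B W"
    using assms(3) by (auto simp: final_coalgebra_def)
  have p: "p i \<in> W \<rightarrow>\<^sub>E fin_seq B pt i" for i
    using lim by (simp add: is_limit_def is_cone_def)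
  obtain \<beta> where \<beta>: "\<beta> \<in> obj B W \<rightarrow>\<^sub>E W"
    and p\<beta>: "\<And>i. compose (obj B W) (p (Suc i)) \<beta> = arr B W (fin_seq B pt i) (p i)"
    and inv: "compose W \<beta> \<zeta> = idm W" "compose (obj B W) \<zeta> \<beta> = idm (obj B W)"
    using assms(4) unfolding carried_by_omega_stage_def by blast
  note FX = functor_obj[OF assms(5) X] and FW = functor_obj[OF assms(5) W]
  \<comment> \<open>Causality speaks about \<alpha> \<circ> F h as a whole, so \<open>R\<close>
    applies \<open>B\<close> once to this composite; \<open>R_eq\<close> recovers the two-factor
    form of the theorem.\<close>
  define \<alpha>F where "\<alpha>F h = compose (obj F X) \<alpha> (arr F X W h)" for h
  define R where "R h = compose X (arr B (obj F X) W (\<alpha>F h)) g" for h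
  have \<alpha>F: "\<alpha>F h \<in> obj F X \<rightarrow>\<^sub>E W" if "h \<in> X \<rightarrow>\<^sub>E W" for h
    unfolding \<alpha>F_def
    by (rule compose_in_extensional_funcset[OF functor_arr[OF assms(5) X W that] assms(6)])
  have R: "R h \<in> X \<rightarrow>\<^sub>E obj B W" if "h \<in> X \<rightarrow>\<^sub>E W" for h
    unfolding R_def
    by (rule compose_in_extensional_funcset[OF g functor_arr[OF B FX W \<alpha>F[OF that]]])
  have R_eq: "R h =
      compose X (arr B (obj F W) W \<alpha>) (compose X (arr B (obj F X) (obj F W) (arr F X W h)) g)"
    if "h \<in> X \<rightarrow>\<^sub>E W" for h
    by (simp only: R_def \<alpha>F_def compose_assoc_extensional[OF g]
        functor_compose[OF B FX FW W functor_arr[OF assms(5) X W that] assms(6)])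
  \<comment> \<open>By \<open>p\<beta>\<close>, stage i + 1 of the new map depends on
    \<open>h\<close> only through stage \<open>i\<close> of \<alpha> \<circ> F h. This shift by one
    is the contraction.\<close>
  have pR: "compose X (p (Suc i)) (compose X \<beta> (R h)) =
      compose X (arr B (obj F X) (fin_seq B pt i) (compose (obj F X) (p i) (\<alpha>F h))) g"
    if h: "h \<in> X \<rightarrow>\<^sub>E W" for h i
    by (simp only: compose_assoc_extensional[OF R[OF h]] p\<beta>)
      (simp only: R_def compose_assoc_extensional[OF g]
        functor_compose[OF B FX W fin_seq_in[OF B pt] \<alpha>F[OF h] p])
  obtain h0 where h0: "h0 \<in> X \<rightarrow>\<^sub>E W"
  proof (cases "X = {}")
    case True
    \<comment> \<open>The extensional function on the empty set; here no element of \<open>W\<close>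
      has to be found.\<close>
    then show ?thesis using that[of "\<lambda>_. undefined"] by simp
  next
    case False
    then obtain x where "x \<in> X" by blast
    then have "g x \<in> obj B (obj F X)"
      using g by blast
    then obtain w where "w \<in> W"
      using final_coalgebra_nonempty[OF B pt assms(3) FX] by blast
    then show ?thesis using that[of "\<lambda>_\<in>X. w"] by simp
  qed
  have "\<exists>!h. h \<in> X \<rightarrow>\<^sub>E W \<and> compose X \<beta> (R h) = h"
  proof (rule limit_contraction_unique_fixpoint[OF lim X h0])
    fix f f' :: "'u \<Rightarrow> 'u" and i
    assume f: "f \<in> X \<rightarrow>\<^sub>E W"
    show "compose X \<beta> (R f) \<in> X \<rightarrow>\<^sub>E W"
      by (rule compose_in_extensional_funcset[OF R[OF f] \<beta>])
    assume f': "f' \<in> X \<rightarrow>\<^sub>E W"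
    \<comment> \<open>Stage 0 is the singleton of \<open>pt\<close>, so any two maps agree there and
      the iteration may start anywhere.\<close>
    have "p 0 w = pt" if "w \<in> W" for w
      using p[of 0] that by auto
    then show "compose X (p 0) f = compose X (p 0) f'"
      using f f' by (auto simp: compose_def fun_eq_iff PiE_mem)
    assume "compose X (p i) f = compose X (p i) f'"
    then have "compose (obj F X) (p i) (\<alpha>F f) = compose (obj F X) (p i) (\<alpha>F f')"
      using assms(7) X f f' unfolding causal_def \<alpha>F_def by blast
    then show "compose X (p (Suc i)) (compose X \<beta> (R f)) =
        compose X (p (Suc i)) (compose X \<beta> (R f'))"
      by (simp add: pR f f')
  qed
  \<comment> \<open>The right-hand side depends on \<open>h\<close> itself, so the inverse law is
    used separately for each \<open>h\<close> with \<open>r\<close> instantiated to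
    \<open>R h\<close>.\<close>
  moreover have "h \<in> X \<rightarrow>\<^sub>E W \<and> compose X \<beta> (R h) = h \<longleftrightarrow> h \<in> X \<rightarrow>\<^sub>E W \<and> compose X \<zeta> h =
      compose X (arr B (obj F W) W \<alpha>) (compose X (arr B (obj F X) (obj F W) (arr F X W h)) g)" for h
    using compose_inverse_iff[OF \<zeta> \<beta> inv _ R, of h h] R_eq[of h] by argo
  ultimately show "\<exists>!h. h \<in> X \<rightarrow>\<^sub>E W \<and> compose X \<zeta> h =
      compose X (arr B (obj F W) W \<alpha>) (compose X (arr B (obj F X) (obj F W) (arr F X W h)) g)"
    by simp
qed

end
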